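(* Suppose that $\sup_{t\in T}\mathrm{E}\left[l^2(\xi-t)\right]<+\infty$. Then, as $n\to\infty$, $v_n\to v^*$ with probability 1 and $D(S_n,S)\to 0$ with probability 1. If, moreover, $S$ is a singleton $\{t^*\}$, then for any $t_n\in S_n$, $t_n\to t^*$ with probability 1.
   Context: Let $u$ be a proper closed concave nondecreasing utility function with $u(0)=0$ and $1\in\partial u(0)$ (subdifferential), and let $l(z)=-u(-z)$ (so $l$ is proper, closed, convex and nondecreasing). Let $\xi$ be a real random variable (the random loss) and $T\subset\mathbb{R}$ a compact interval. The OCE (optimized certainty equivalent) risk measure of the loss $\xi$ is the optimal value of $$\min_{t\in T}\ t+\mathrm{E}[l(\xi-t)].$$ Let $v^*$ and $S$ denote the optimal value and the set of optimal solutions of this problem. Let $\xi_1,\xi_2,\ldots$ be i.i.d. copies of $\xi$, and let $v_n$ and $S_n$ denote the optimal value and the set of optimal solutions of the sample average approximation $$\min_{t\in T}\ t+\frac1n\sum_{i=1}^n l(\xi_i-t).$$ For sets $A,B\subset\mathbb{R}$, $D(A,B)=\sup_{x\in A}d(x,B)$ where $d(x,B)=\inf_{y\in B}\|x-y\|$. *)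

theory Defs
  imports "HOL-Probability.Probability"
begin

section \<open>Extended-real-valued concave functions on the line\<close>

definition hypograph :: "(real \<Rightarrow> ereal) \<Rightarrow> (real \<times> real) set" where
  "hypograph u = {(x, r). ereal r \<le> u x}"

definition proper_concave :: "(real \<Rightarrow> ereal) \<Rightarrow> bool" where
  "proper_concave u \<longleftrightarrow>
     (\<forall>x. u x \<noteq> \<infinity>) \<and> (\<exists>x. u x \<noteq> -\<infinity>) \<and> convex (hypograph u)"

text \<open>For concave functions the subdifferential is the set of slopes of affine majorants
  that are exact at the given point.\<close>

definition concave_subdifferential :: "(real \<Rightarrow> ereal) \<Rightarrow> real \<Rightarrow> real set" where
  "concave_subdifferential u x = {g. \<forall>z. u z \<le> u x + ereal (g * (z - x))}"

text \<open>A proper concave function is closed iff it is upper semicontinuous, that is, iff its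
  hypograph is closed.\<close>

definition utility_function :: "(real \<Rightarrow> ereal) \<Rightarrow> bool" where
  "utility_function u \<longleftrightarrow>
     proper_concave u \<and> closed (hypograph u) \<and> mono u \<and>
     u 0 = 0 \<and> 1 \<in> concave_subdifferential u 0"

definition loss_function :: "(real \<Rightarrow> ereal) \<Rightarrow> real \<Rightarrow> ereal" where
  "loss_function u z = - u (- z)"


section \<open>The OCE problem and its sample average approximation\<close>

text \<open>Expectation of an extended-real random variable, as the expectation of the positive part
  minus that of the negative part (\<^const>\<open>e2ennreal\<close> maps negative numbers to 0). If both
  are infinite the value is \<open>\<infinity>\<close>, as \<open>\<infinity> - \<infinity> = \<infinity>\<close> in \<^typ>\<open>ereal\<close>.\<close>

definition ext_expectation :: "'a measure \<Rightarrow> ('a \<Rightarrow> ereal) \<Rightarrow> ereal" where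
  "ext_expectation M Y =
     enn2ereal (\<integral>\<^sup>+ \<omega>. e2ennreal (Y \<omega>) \<partial>M) - enn2ereal (\<integral>\<^sup>+ \<omega>. e2ennreal (- Y \<omega>) \<partial>M)"

definition oce_objective ::
    "(real \<Rightarrow> ereal) \<Rightarrow> 'a measure \<Rightarrow> ('a \<Rightarrow> real) \<Rightarrow> real \<Rightarrow> ereal" where
  "oce_objective l M \<xi> t = ereal t + ext_expectation M (\<lambda>\<omega>. l (\<xi> \<omega> - t))"

text \<open>The sample is numbered from 1; the case \<open>n = 0\<close> is meaningless.\<close>

definition saa_objective ::
    "(real \<Rightarrow> ereal) \<Rightarrow> (nat \<Rightarrow> 'a \<Rightarrow> real) \<Rightarrow> nat \<Rightarrow> 'a \<Rightarrow> real \<Rightarrow> ereal" where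
  "saa_objective l X n \<omega> t = ereal t + ereal (1 / real n) * (\<Sum>i=1..n. l (X i \<omega> - t))"

definition optimal_value :: "real set \<Rightarrow> (real \<Rightarrow> ereal) \<Rightarrow> ereal" where
  "optimal_value T f = (INF t\<in>T. f t)"

definition optimal_solutions :: "real set \<Rightarrow> (real \<Rightarrow> ereal) \<Rightarrow> real set" where
  "optimal_solutions T f = {t \<in> T. \<forall>s\<in>T. f t \<le> f s}"

text \<open>The one-sided deviation of \<open>A\<close> from \<open>B\<close>. Being taken in \<^typ>\<open>ereal\<close>, it is
  \<open>-\<infinity>\<close> for empty \<open>A\<close> and \<open>\<infinity>\<close> for nonempty \<open>A\<close> and empty \<open>B\<close>; convergence to 0 thus
  never holds because of empty sets.\<close>

definition set_deviation :: "real set \<Rightarrow> real set \<Rightarrow> ereal" where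
  "set_deviation A B = (SUP x\<in>A. INF y\<in>B. ereal (dist x y))"

end

theory Submission
  imports Defs "HOL-Library.Discrete_Functions"
begin

text \<open>The expected and the empirical OCE objectives differ from \<open>t\<close> by a mean of the loss
  \<open>l (\<xi> - t)\<close>, and everything follows once the empirical means converge to the expected loss
  uniformly in \<open>t\<close> on the compact interval \<open>T = {a..b}\<close>, almost surely, and the limit is
  continuous. Uniform convergence of continuous objectives on a compact set makes the optimal values
  converge (\<open>optimal_value_tendsto\<close>) and drives the minimizers towards the minimizers of the limit
  (\<open>optimal_solutions_eventually_near\<close>).

  Uniformity comes from monotonicity. The loss is nondecreasing, so expected and empirical
  losses are nonincreasing in \<open>t\<close>, and pointwise convergence on a suitable countable set to a
  continuous function is automatically uniform (\<open>uniform_limit_of_antimono_functions\<close>). Pointwise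
  convergence is the strong law of large numbers. As the moment condition makes
  \<open>l (\<xi> - t)\<close> square integrable, its elementary \<open>L\<^sup>2\<close> version is enough
  (\<open>strong_law_of_large_numbers_L2\<close>).

  The loss may take the value \<open>\<infinity>\<close>. The moment condition at \<open>t = a\<close> makes \<open>l (\<xi> - a)\<close> finite
  almost surely, and then \<open>l\<close> is finite on the whole ray below \<open>\<xi> - a\<close>, which contains
  \<open>\<xi> - t\<close> for every \<open>t \<in> T\<close>. On such a ray \<open>l\<close> is continuous up to and including the
  endpoint, because it is closed and convex (\<open>continuous_on_real_loss\<close>). Hence the empirical
  objectives are continuous, and so is the expected one by dominated convergence.\<close>

section \<open>A strong law of large numbers for square-integrable variables\<close>

text \<open>For \<open>k\<^sup>2 \<le> n \<le> (k + 1)\<^sup>2\<close> the monotone sum \<open>s n\<close> lies between its values at the two squares, and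
the ratio of consecutive squares tends to 1. This is why nonnegative summands need to be
controlled only along the squares.\<close>
lemma averages_tendsto_if_along_squares:
  fixes s :: "nat \<Rightarrow> real"
  assumes "mono s" and "s 0 \<ge> 0"
    and lim: "(\<lambda>k. s (k\<^sup>2) / real (k\<^sup>2)) \<longlonglongrightarrow> c"
  shows "(\<lambda>n. s n / real n) \<longlonglongrightarrow> c"
proof (rule tendsto_sandwich)
  have s_nonneg: "s n \<ge> 0" for n
    using assms(1,2) by (meson le0 monoD order_trans)
  have root: "filterlim floor_sqrt at_top sequentially"
    unfolding filterlim_at_top eventually_sequentially
    by (metis floor_sqrt_inverse_power2 mono_floor_sqrt')
  \<comment> \<open>With \<open>k = floor_sqrt n\<close>, the two bounds are the averages at \<open>k\<^sup>2\<close> and at \<open>(k + 1)\<^sup>2\<close>,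
    corrected by the ratio of the two squares.\<close>
  define q where "q k = s (k\<^sup>2) / real (k\<^sup>2)" for k
  have q: "q \<longlonglongrightarrow> c" using lim by (simp add: q_def[abs_def])
  have "(\<lambda>k. q k * (real k / real (Suc k))\<^sup>2) \<longlonglongrightarrow> c * 1\<^sup>2"
    by (intro tendsto_intros q LIMSEQ_n_over_Suc_n)
  then show "(\<lambda>n. q (floor_sqrt n) * (real (floor_sqrt n) / real (Suc (floor_sqrt n)))\<^sup>2) \<longlonglongrightarrow> c"
    using filterlim_compose[OF _ root] by fastforce
  have "(\<lambda>k. q (Suc k) * (real (Suc k) / real k)\<^sup>2) \<longlonglongrightarrow> c * 1\<^sup>2"
    by (intro tendsto_intros LIMSEQ_Suc[OF q] LIMSEQ_Suc_n_over_n)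
  then show "(\<lambda>n. q (Suc (floor_sqrt n)) * (real (Suc (floor_sqrt n)) / real (floor_sqrt n))\<^sup>2) \<longlonglongrightarrow> c"
    using filterlim_compose[OF _ root] by fastforce
  have bounds: "q k * (real k / real (Suc k))\<^sup>2 \<le> s n / real n
      \<and> s n / real n \<le> q (Suc k) * (real (Suc k) / real k)\<^sup>2"
    if k: "k = floor_sqrt n" "n \<ge> 1" for n k
  proof
    have kn: "k\<^sup>2 \<le> n" "n \<le> (Suc k)\<^sup>2" and "k \<ge> 1"
      using k by (simp, simp add: Suc_floor_sqrt_power2_gt less_imp_le, simp add: Suc_leI)
    have "q k * (real k / real (Suc k))\<^sup>2 = s (k\<^sup>2) / real ((Suc k)\<^sup>2)"
      using \<open>k \<ge> 1\<close> by (simp add: q_def power_divide del: of_nat_Suc)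
    also have "\<dots> \<le> s n / real n"
      using kn k(2) s_nonneg by (intro frac_le) (auto intro: monoD[OF assms(1)] simp del: of_nat_power)
    finally show "q k * (real k / real (Suc k))\<^sup>2 \<le> s n / real n" .
    have "s n / real n \<le> s ((Suc k)\<^sup>2) / real (k\<^sup>2)"
      using kn \<open>k \<ge> 1\<close> s_nonneg by (intro frac_le) (auto intro: monoD[OF assms(1)] simp del: of_nat_power)
    also have "\<dots> = q (Suc k) * (real (Suc k) / real k)\<^sup>2"
      by (simp add: q_def power_divide del: of_nat_Suc)
    finally show "s n / real n \<le> q (Suc k) * (real (Suc k) / real k)\<^sup>2" .
  qed
  show "\<forall>\<^sub>F n in sequentially. q (floor_sqrt n) * (real (floor_sqrt n) / real (Suc (floor_sqrt n)))\<^sup>2 \<le> s n / real n"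
    using eventually_ge_at_top[of 1] by eventually_elim (use bounds in blast)
  show "\<forall>\<^sub>F n in sequentially. s n / real n \<le> q (Suc (floor_sqrt n)) * (real (Suc (floor_sqrt n)) / real (floor_sqrt n))\<^sup>2"
    using eventually_ge_at_top[of 1] by eventually_elim (use bounds in blast)
qed

context prob_space
begin

text \<open>Orthogonality: by independence the cross terms have expectation zero, so the second moment of
a sum of \<open>n\<close> centered variables grows only linearly in \<open>n\<close>.\<close>
lemma second_moment_sum_centered:
  fixes Y :: "'i \<Rightarrow> 'a \<Rightarrow> real"
  assumes "finite A" and "indep_vars (\<lambda>_. borel) Y A"
    and "\<And>i. i \<in> A \<Longrightarrow> integrable M (\<lambda>\<omega>. (Y i \<omega>)\<^sup>2)"
    and "\<And>i. i \<in> A \<Longrightarrow> expectation (Y i) = 0"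
  shows "integrable M (\<lambda>\<omega>. (\<Sum>i\<in>A. Y i \<omega>)\<^sup>2)
    \<and> expectation (\<lambda>\<omega>. (\<Sum>i\<in>A. Y i \<omega>)\<^sup>2) = (\<Sum>i\<in>A. expectation (\<lambda>\<omega>. (Y i \<omega>)\<^sup>2))"
  using assms
proof (induction A rule: finite_induct)
  case empty
  then show ?case by simp
next
  case (insert j A)
  define Z where "Z \<omega> = (\<Sum>i\<in>A. Y i \<omega>)" for \<omega>
  have meas: "Y i \<in> borel_measurable M" if "i \<in> insert j A" for i
    using insert.prems(1) that unfolding indep_vars_def by blast
  have int: "integrable M (Y i)" if "i \<in> insert j A" for i
    using square_integrable_imp_integrable[OF meas insert.prems(2)] that by blast
  have "indep_vars (\<lambda>_. borel) Y A"
    using indep_vars_subset[OF insert.prems(1)] by blast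
  then have IH: "integrable M (\<lambda>\<omega>. (Z \<omega>)\<^sup>2)"
      "expectation (\<lambda>\<omega>. (Z \<omega>)\<^sup>2) = (\<Sum>i\<in>A. expectation (\<lambda>\<omega>. (Y i \<omega>)\<^sup>2))"
    using insert.IH insert.prems by (auto simp: Z_def)
  have intZ: "integrable M Z"
    unfolding Z_def using int by (intro Bochner_Integration.integrable_sum) auto
  have indep: "indep_var borel (Y j) borel Z"
    using indep_vars_sum[OF insert.hyps insert.prems(1)] by (simp add: Z_def[abs_def])
  have cross: "integrable M (\<lambda>\<omega>. Y j \<omega> * Z \<omega>)" "expectation (\<lambda>\<omega>. Y j \<omega> * Z \<omega>) = 0"
    using indep_var_integrable[OF indep] indep_var_lebesgue_integral[OF indep] int intZ
      insert.prems(3)[of j] by auto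
  have "(\<Sum>i\<in>insert j A. Y i \<omega>)\<^sup>2 = (Y j \<omega>)\<^sup>2 + 2 * (Y j \<omega> * Z \<omega>) + (Z \<omega>)\<^sup>2" for \<omega>
    using insert.hyps by (simp add: Z_def power2_sum)
  then show ?case
    using insert.prems(2) IH cross insert.hyps by simp
qed

text \<open>The mean square error of the average of \<open>k\<^sup>2\<close> variables is of order \<open>1 / k\<^sup>2\<close>, which is summable.
Hence the sum over \<open>k\<close> of the squared errors has finite expectation and is almost surely finite,
so the errors tend to zero along the squares; monotonicity of the partial sums fills the gaps.\<close>
lemma strong_law_of_large_numbers_nonneg:
  fixes Y :: "nat \<Rightarrow> 'a \<Rightarrow> real"
  assumes indep: "indep_vars (\<lambda>_. borel) Y {1..}"
    and int: "\<And>i. i \<ge> 1 \<Longrightarrow> integrable M (\<lambda>\<omega>. (Y i \<omega>)\<^sup>2)"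
    and mean: "\<And>i. i \<ge> 1 \<Longrightarrow> expectation (Y i) = \<mu>"
    and sq: "\<And>i. i \<ge> 1 \<Longrightarrow> expectation (\<lambda>\<omega>. (Y i \<omega>)\<^sup>2) = c"
    and nonneg: "\<And>i \<omega>. Y i \<omega> \<ge> 0"
  shows "AE \<omega> in M. (\<lambda>n. (\<Sum>i=1..n. Y i \<omega>) / real n) \<longlonglongrightarrow> \<mu>"
proof -
  define Z where "Z i \<omega> = Y i \<omega> - \<mu>" for i \<omega>
  have meas[measurable]: "Y i \<in> borel_measurable M" if "i \<ge> 1" for i
    using indep that unfolding indep_vars_def by simp
  have intY: "integrable M (Y i)" if "i \<ge> 1" for i
    using square_integrable_imp_integrable[OF meas int] that by blast
  have indepZ: "indep_vars (\<lambda>_. borel) Z {1..}"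
    unfolding Z_def using indep by (rule indep_vars_compose2) simp
  have Z: "integrable M (\<lambda>\<omega>. (Z i \<omega>)\<^sup>2)" "expectation (Z i) = 0"
      "expectation (\<lambda>\<omega>. (Z i \<omega>)\<^sup>2) = c - \<mu>\<^sup>2" if "i \<ge> 1" for i
  proof -
    show "expectation (\<lambda>\<omega>. (Z i \<omega>)\<^sup>2) = c - \<mu>\<^sup>2"
      using variance_eq[OF intY int] that mean sq by (simp add: Z_def)
    show "expectation (Z i) = 0"
      using intY that mean by (simp add: Z_def[abs_def] prob_space)
    show "integrable M (\<lambda>\<omega>. (Z i \<omega>)\<^sup>2)"
      unfolding Z_def power2_diff using int intY that by simp
  qed
  define D where "D k \<omega> = ((\<Sum>i=1..k\<^sup>2. Z i \<omega>) / real (k\<^sup>2))\<^sup>2" for k \<omega>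
  have D: "integrable M (D k)" "expectation (D k) = (c - \<mu>\<^sup>2) / real k ^ 2" for k
  proof -
    have *: "integrable M (\<lambda>\<omega>. (\<Sum>i=1..k\<^sup>2. Z i \<omega>)\<^sup>2)
      \<and> expectation (\<lambda>\<omega>. (\<Sum>i=1..k\<^sup>2. Z i \<omega>)\<^sup>2) = (\<Sum>i=1..k\<^sup>2. expectation (\<lambda>\<omega>. (Z i \<omega>)\<^sup>2))"
      by (rule second_moment_sum_centered) (auto intro: indep_vars_subset[OF indepZ] Z)
    then show "integrable M (D k)"
      by (simp add: D_def[abs_def] power_divide)
    have "expectation (D k) = (\<Sum>i=1..k\<^sup>2. expectation (\<lambda>\<omega>. (Z i \<omega>)\<^sup>2)) / (real (k\<^sup>2))\<^sup>2"
      using * by (simp add: D_def[abs_def] power_divide)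
    also have "(\<Sum>i=1..k\<^sup>2. expectation (\<lambda>\<omega>. (Z i \<omega>)\<^sup>2)) = real (k\<^sup>2) * (c - \<mu>\<^sup>2)"
      using Z(3) by simp
    finally show "expectation (D k) = (c - \<mu>\<^sup>2) / real k ^ 2"
      by (simp add: power2_eq_square)
  qed
  have "(\<integral>\<^sup>+\<omega>. (\<Sum>k. ennreal (D k \<omega>)) \<partial>M) = (\<Sum>k. \<integral>\<^sup>+\<omega>. ennreal (D k \<omega>) \<partial>M)"
    using D(1) by (intro nn_integral_suminf) auto
  also have "\<dots> = (\<Sum>k. ennreal (expectation (D k)))"
    using D(1) by (intro arg_cong[where f=suminf] ext nn_integral_eq_integral) (simp_all add: D_def[abs_def])
  also have "\<dots> \<noteq> \<infinity>"
  proof -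
    have "summable (\<lambda>k. expectation (D k))"
      unfolding D(2) divide_inverse
      by (intro summable_mult) (use inverse_power_summable[of 2, where 'a=real] in simp)
    then show ?thesis
      by (simp add: ennreal_suminf_neq_top D_def)
  qed
  finally have "AE \<omega> in M. (\<Sum>k. ennreal (D k \<omega>)) \<noteq> \<infinity>"
    using D(1) by (intro nn_integral_PInf_AE) auto
  then show ?thesis
  proof eventually_elim
    case (elim \<omega>)
    have "summable (\<lambda>k. D k \<omega>)"
      using elim by (intro summable_suminf_not_top) (auto simp: D_def)
    then have "(\<lambda>k. sqrt (D k \<omega>)) \<longlonglongrightarrow> sqrt 0"
      by (intro tendsto_real_sqrt summable_LIMSEQ_zero)
    then have "(\<lambda>k. \<bar>(\<Sum>i=1..k\<^sup>2. Z i \<omega>) / real (k\<^sup>2)\<bar>) \<longlonglongrightarrow> 0"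
      unfolding D_def by (simp only: real_sqrt_abs real_sqrt_zero)
    then have "(\<lambda>k. (\<Sum>i=1..k\<^sup>2. Z i \<omega>) / real (k\<^sup>2)) \<longlonglongrightarrow> 0"
      by (rule tendsto_rabs_zero_cancel)
    then have "(\<lambda>k. (\<Sum>i=1..k\<^sup>2. Z i \<omega>) / real (k\<^sup>2) + \<mu>) \<longlonglongrightarrow> 0 + \<mu>"
      by (intro tendsto_intros)
    moreover have "\<forall>\<^sub>F k in sequentially.
        (\<Sum>i=1..k\<^sup>2. Z i \<omega>) / real (k\<^sup>2) + \<mu> = (\<Sum>i=1..k\<^sup>2. Y i \<omega>) / real (k\<^sup>2)"
      using eventually_gt_at_top[of 0]
      by eventually_elim (simp add: Z_def sum_subtractf field_simps)
    ultimately have "(\<lambda>k. (\<Sum>i=1..k\<^sup>2. Y i \<omega>) / real (k\<^sup>2)) \<longlonglongrightarrow> \<mu>"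
      using Lim_transform_eventually by fastforce
    moreover have "mono (\<lambda>n. \<Sum>i=1..n. Y i \<omega>)"
      by (intro monoI sum_mono2) (auto simp: nonneg)
    ultimately show ?case
      by (intro averages_tendsto_if_along_squares[where s="\<lambda>n. \<Sum>i=1..n. Y i \<omega>"]) auto
  qed
qed

text \<open>The positive and the negative part inherit independence, equality of distributions and square
integrability, so the general case is the difference of two nonnegative ones.\<close>
theorem strong_law_of_large_numbers_L2:
  fixes Y :: "nat \<Rightarrow> 'a \<Rightarrow> real"
  assumes indep: "indep_vars (\<lambda>_. borel) Y {1..}"
    and distr: "\<And>i. i \<ge> 1 \<Longrightarrow> distr M borel (Y i) = distr M borel \<eta>"
    and [measurable]: "\<eta> \<in> borel_measurable M"
    and int: "integrable M (\<lambda>\<omega>. (\<eta> \<omega>)\<^sup>2)"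
  shows "AE \<omega> in M. (\<lambda>n. (\<Sum>i=1..n. Y i \<omega>) / real n) \<longlonglongrightarrow> expectation \<eta>"
proof -
  have meas: "Y i \<in> borel_measurable M" if "i \<ge> 1" for i
    using indep that unfolding indep_vars_def by simp
  \<comment> \<open>Both parts are of the form \<open>f (Y i)\<close> with \<open>0 \<le> f x \<le> \<bar>x\<bar>\<close>.\<close>
  have law: "AE \<omega> in M. (\<lambda>n. (\<Sum>i=1..n. f (Y i \<omega>)) / real n) \<longlonglongrightarrow> expectation (\<lambda>\<omega>. f (\<eta> \<omega>))"
    if [measurable]: "f \<in> borel_measurable borel"
      and f: "\<And>x. 0 \<le> f x \<and> f x \<le> \<bar>x\<bar>" for f :: "real \<Rightarrow> real"
  proof (rule strong_law_of_large_numbers_nonneg)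
    have transfer: "(integrable M (\<lambda>\<omega>. g (Y i \<omega>)) \<longleftrightarrow> integrable M (\<lambda>\<omega>. g (\<eta> \<omega>)))
        \<and> expectation (\<lambda>\<omega>. g (Y i \<omega>)) = expectation (\<lambda>\<omega>. g (\<eta> \<omega>))"
      if "i \<ge> 1" "g \<in> borel_measurable borel" for i and g :: "real \<Rightarrow> real"
      using integrable_distr_eq[OF meas[OF that(1)], of g] integrable_distr_eq[of \<eta> M borel g]
        integral_distr[OF meas[OF that(1)], of g] integral_distr[of \<eta> M borel g] that distr by auto
    have "integrable M (\<lambda>\<omega>. (f (\<eta> \<omega>))\<^sup>2)"
    proof (rule Bochner_Integration.integrable_bound[OF int])
      show "AE \<omega> in M. norm ((f (\<eta> \<omega>))\<^sup>2) \<le> norm ((\<eta> \<omega>)\<^sup>2)"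
        using f by (intro AE_I2) (simp add: abs_le_square_iff[symmetric])
    qed simp
    then show "integrable M (\<lambda>\<omega>. (f (Y i \<omega>))\<^sup>2)" if "i \<ge> 1" for i
      using transfer[OF that, of "\<lambda>x. (f x)\<^sup>2"] by simp
    show "expectation (\<lambda>\<omega>. f (Y i \<omega>)) = expectation (\<lambda>\<omega>. f (\<eta> \<omega>))"
      "expectation (\<lambda>\<omega>. (f (Y i \<omega>))\<^sup>2) = expectation (\<lambda>\<omega>. (f (\<eta> \<omega>))\<^sup>2)" if "i \<ge> 1" for i
      using transfer[OF that, of f] transfer[OF that, of "\<lambda>x. (f x)\<^sup>2"] by simp_all
    show "indep_vars (\<lambda>_. borel) (\<lambda>i \<omega>. f (Y i \<omega>)) {1..}"
      using indep by (rule indep_vars_compose2) simp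
  qed (use f in auto)
  have [simp]: "integrable M \<eta>"
    using square_integrable_imp_integrable[OF _ int] by simp
  have "expectation \<eta> = expectation (\<lambda>\<omega>. max 0 (\<eta> \<omega>) - max 0 (- \<eta> \<omega>))"
    by (intro Bochner_Integration.integral_cong) (auto simp: max_def)
  also have "\<dots> = expectation (\<lambda>\<omega>. max 0 (\<eta> \<omega>)) - expectation (\<lambda>\<omega>. max 0 (- \<eta> \<omega>))"
    by (intro Bochner_Integration.integral_diff integrable_max) simp_all
  finally have split: "expectation \<eta> = \<dots>" .
  have "AE \<omega> in M. (\<lambda>n. (\<Sum>i=1..n. max 0 (Y i \<omega>)) / real n) \<longlonglongrightarrow> expectation (\<lambda>\<omega>. max 0 (\<eta> \<omega>))"
    by (rule law) auto
  moreover have "AE \<omega> in M. (\<lambda>n. (\<Sum>i=1..n. max 0 (- Y i \<omega>)) / real n) \<longlonglongrightarrow> expectation (\<lambda>\<omega>. max 0 (- \<eta> \<omega>))"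
    by (rule law) auto
  ultimately show ?thesis
  proof eventually_elim
    case (elim \<omega>)
    have "(\<Sum>i=1..n. Y i \<omega>) / real n
        = (\<Sum>i=1..n. max 0 (Y i \<omega>)) / real n - (\<Sum>i=1..n. max 0 (- Y i \<omega>)) / real n" for n
      unfolding diff_divide_distrib[symmetric] sum_subtractf[symmetric]
      by (intro arg_cong2[where f="(/)"] sum.cong) (auto simp: max_def)
    then show ?case
      using tendsto_diff[OF elim] by (simp add: split)
  qed
qed

end


section \<open>Uniform convergence of monotone functions\<close>

text \<open>A variant of Polya's theorem. On a grid so fine that the limit varies by less than \<open>e / 2\<close> over
each cell, the values of a monotone function inside a cell are trapped between those at the
grid points, where convergence holds simultaneously for all but finitely many \<open>n\<close>. The points at
rational fractions of the interval contain all regular grids, including the two endpoints, and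
they are countably many, so that in a probabilistic setting null sets can be united.\<close>
lemma uniform_limit_of_antimono_functions:
  fixes F :: "nat \<Rightarrow> real \<Rightarrow> real"
  assumes "a \<le> b"
    and antimono: "\<And>n. antimono_on {a..b} (F n)"
    and cont: "continuous_on {a..b} G"
    and lim: "\<And>q. q \<in> \<rat> \<inter> {0..1} \<Longrightarrow>
      (\<lambda>n. F n (a + (b - a) * q)) \<longlonglongrightarrow> G (a + (b - a) * q)"
  shows "uniform_limit {a..b} F G sequentially"
proof (rule uniform_limitI)
  fix e :: real
  assume "e > 0"
  obtain d where "d > 0" and d: "\<And>s t. s \<in> {a..b} \<Longrightarrow> t \<in> {a..b} \<Longrightarrow> dist s t < d \<Longrightarrow> dist (G s) (G t) < e / 2"
    using compact_uniformly_continuous[OF cont compact_Icc] \<open>e > 0\<close>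
    unfolding uniformly_continuous_on_def by (metis half_gt_zero)
  obtain N :: nat where N: "(b - a) / d < real N"
    using reals_Archimedean2 by blast
  have "0 \<le> (b - a) / d"
    using \<open>a \<le> b\<close> \<open>d > 0\<close> by simp
  with N have "N > 0"
    by (intro gr0I) simp
  with N have "(b - a) / real N < d"
    using \<open>d > 0\<close> by (simp add: field_simps)
  define p where "p k = a + (b - a) * (real k / real N)" for k
  have p_mem: "p k \<in> {a..b}" if "k \<le> N" for k
    using that \<open>a \<le> b\<close> \<open>N > 0\<close> mult_left_le[of "real k / real N" "b - a"] by (auto simp: p_def)
  have grid: "\<exists>i\<le>N. \<exists>j\<le>N. p i \<le> t \<and> t \<le> p j \<and> p j - p i < d" if t: "t \<in> {a..b}" for t
  proof -
    define k where "k = (LEAST k. t \<le> p k)"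
    have "t \<le> p N"
      using t \<open>N > 0\<close> by (simp add: p_def)
    then have k: "t \<le> p k" "k \<le> N"
      unfolding k_def by (auto intro: LeastI Least_le)
    show ?thesis
    proof (cases k)
      case 0
      then show ?thesis
        using k t \<open>d > 0\<close> by (intro exI[of _ 0] conjI) (simp_all add: p_def)
    next
      case (Suc i)
      have "p i < t"
        using not_less_Least[of i "\<lambda>k. t \<le> p k"] Suc by (simp add: k_def)
      moreover have "p (Suc i) - p i = (b - a) / real N"
        using \<open>N > 0\<close> by (simp add: p_def field_simps)
      ultimately show ?thesis
        using Suc k \<open>(b - a) / real N < d\<close> by (intro exI[of _ i] conjI exI[of _ k]) auto
    qed
  qed
  have "\<forall>\<^sub>F n in sequentially. \<forall>k\<in>{..N}. dist (F n (p k)) (G (p k)) < e / 2"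
  proof (intro eventually_ball_finite ballI)
    fix k assume "k \<in> {..N}"
    then have "real k / real N \<in> \<rat> \<inter> {0..1}"
      using \<open>N > 0\<close> by simp
    from lim[OF this] show "\<forall>\<^sub>F n in sequentially. dist (F n (p k)) (G (p k)) < e / 2"
      unfolding p_def using \<open>e > 0\<close> by (intro tendstoD) auto
  qed simp
  then show "\<forall>\<^sub>F n in sequentially. \<forall>t\<in>{a..b}. dist (F n t) (G t) < e"
  proof eventually_elim
    case (elim n)
    show ?case
    proof
      fix t assume t: "t \<in> {a..b}"
      obtain i j where ij: "i \<le> N" "j \<le> N" "p i \<le> t" "t \<le> p j" "p j - p i < d"
        using grid[OF t] by blast
      have "F n (p j) \<le> F n t" "F n t \<le> F n (p i)"
        using antimono[of n] p_mem ij t unfolding monotone_on_def by blast+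
      moreover have "dist (F n (p i)) (G (p i)) < e / 2" "dist (F n (p j)) (G (p j)) < e / 2"
        using elim ij by auto
      moreover have "dist (G (p i)) (G t) < e / 2" "dist (G (p j)) (G t) < e / 2"
        using ij t p_mem by (intro d; simp add: dist_real_def)+
      ultimately show "dist (F n t) (G t) < e"
        unfolding dist_real_def by linarith
    qed
  qed
qed


section \<open>Stability of minimizers under uniform convergence\<close>

lemma optimal_solutions_ereal:
  "optimal_solutions T (\<lambda>t. ereal (G t)) = {t\<in>T. \<forall>s\<in>T. G t \<le> G s}"
  by (simp add: optimal_solutions_def)

lemma optimal_solutions_nonempty:
  assumes "compact T" "T \<noteq> {}" "continuous_on T G"
  shows "optimal_solutions T (\<lambda>t. ereal (G t)) \<noteq> {}"
  using continuous_attains_inf[OF assms] by (auto simp: optimal_solutions_ereal)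

lemma optimal_value_eq:
  assumes "s \<in> optimal_solutions T f"
  shows "optimal_value T f = f s"
  using assms unfolding optimal_value_def optimal_solutions_def
  by (intro antisym INF_lower INF_greatest) auto

lemma optimal_value_tendsto:
  assumes "compact T" "T \<noteq> {}" "continuous_on T G"
    and unif: "uniform_limit T F G sequentially"
  shows "(\<lambda>n. optimal_value T (\<lambda>t. ereal (F n t))) \<longlonglongrightarrow> optimal_value T (\<lambda>t. ereal (G t))"
proof -
  obtain s where s: "s \<in> optimal_solutions T (\<lambda>t. ereal (G t))"
    using optimal_solutions_nonempty[OF assms(1-3)] by blast
  then have "s \<in> T" and min: "\<And>t. t \<in> T \<Longrightarrow> G s \<le> G t"
    by (auto simp: optimal_solutions_ereal)
  have "(\<lambda>n. optimal_value T (\<lambda>t. ereal (F n t))) \<longlonglongrightarrow> ereal (G s)"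
  proof (rule order_tendstoI)
    fix c assume "c < ereal (G s)"
    then obtain r where r: "c < ereal r" "r < G s"
      using ereal_dense2 by force
    have "\<forall>\<^sub>F n in sequentially. \<forall>t\<in>T. dist (F n t) (G t) < G s - r"
      using unif r by (intro uniform_limitD) auto
    then show "\<forall>\<^sub>F n in sequentially. c < optimal_value T (\<lambda>t. ereal (F n t))"
    proof eventually_elim
      case (elim n)
      have "r \<le> F n t" if "t \<in> T" for t
        using elim min[OF that] that by (force simp: dist_real_def)
      then have "ereal r \<le> optimal_value T (\<lambda>t. ereal (F n t))"
        unfolding optimal_value_def by (intro INF_greatest) simp
      with r show ?case by order
    qed
  next
    fix c assume "ereal (G s) < c"
    have "(\<lambda>n. ereal (F n s)) \<longlonglongrightarrow> ereal (G s)"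
      using tendsto_uniform_limitI[OF unif \<open>s \<in> T\<close>] by simp
    from order_tendstoD(2)[OF this \<open>ereal (G s) < c\<close>]
    show "\<forall>\<^sub>F n in sequentially. optimal_value T (\<lambda>t. ereal (F n t)) < c"
      by eventually_elim (use \<open>s \<in> T\<close> in \<open>auto simp: optimal_value_def INF_less_iff\<close>)
  qed
  then show ?thesis
    by (simp add: optimal_value_eq[OF s])
qed

text \<open>The points of \<open>T\<close> at distance at least \<open>e\<close> from the optimal set of the limit problem form a compact
set, on which the limit objective exceeds its minimum by a positive gap. An objective that is
uniformly closer than half of this gap cannot have a minimizer there.\<close>
lemma optimal_solutions_eventually_near:
  assumes "compact T" "T \<noteq> {}" "continuous_on T G"
    and unif: "uniform_limit T F G sequentially" and "e > 0"
  shows "\<forall>\<^sub>F n in sequentially. \<forall>x\<in>optimal_solutions T (\<lambda>t. ereal (F n t)).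
           \<exists>y\<in>optimal_solutions T (\<lambda>t. ereal (G t)). dist x y < e"
proof -
  define S where "S = optimal_solutions T (\<lambda>t. ereal (G t))"
  obtain s where s: "s \<in> T" "\<And>t. t \<in> T \<Longrightarrow> G s \<le> G t"
    using optimal_solutions_nonempty[OF assms(1-3)] by (auto simp: optimal_solutions_ereal)
  define K where "K = T \<inter> (\<Inter>y\<in>S. {t. e \<le> dist t y})"
  have "compact K"
    unfolding K_def using \<open>compact T\<close>
    by (intro compact_Int_closed closed_INT ballI closed_Collect_le continuous_intros) auto
  have near: "\<exists>y\<in>S. dist x y < e" if "x \<in> T - K" for x
    using that by (auto simp: K_def not_le)
  show ?thesis
  proof (cases "K = {}")
    case True
    then show ?thesis
      using near by (auto simp: S_def optimal_solutions_def)
  next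
    case False
    obtain k where k: "k \<in> K" "\<And>t. t \<in> K \<Longrightarrow> G k \<le> G t"
      using continuous_attains_inf[OF \<open>compact K\<close> False, of G] continuous_on_subset[OF assms(3)]
      unfolding K_def by blast
    have "k \<in> T" "k \<notin> S"
      using k(1) \<open>e > 0\<close> by (auto simp: K_def)
    then have "G s < G k"
      using s by (force simp: S_def optimal_solutions_ereal)
    then have "\<forall>\<^sub>F n in sequentially. \<forall>t\<in>T. dist (F n t) (G t) < (G k - G s) / 2"
      using unif by (intro uniform_limitD) auto
    then show ?thesis
    proof eventually_elim
      case (elim n)
      have "x \<notin> K" if x: "x \<in> optimal_solutions T (\<lambda>t. ereal (F n t))" for x
      proof
        assume "x \<in> K"
        have "x \<in> T" "F n x \<le> F n s"
          using x s(1) by (auto simp: optimal_solutions_ereal)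
        moreover have "dist (F n x) (G x) < (G k - G s) / 2" "dist (F n s) (G s) < (G k - G s) / 2"
          using elim \<open>x \<in> T\<close> s(1) by auto
        ultimately show False
          using k(2)[OF \<open>x \<in> K\<close>] by (simp add: dist_real_def abs_if split: if_splits)
      qed
      then show ?case
        using near by (auto simp: S_def optimal_solutions_def)
    qed
  qed
qed

text \<open>Continuity of each \<open>F n\<close> makes its optimal set nonempty, which is needed since the deviation of the
empty set is \<open>-\<infinity>\<close>.\<close>
lemma set_deviation_optimal_solutions_tendsto_0:
  assumes T: "compact T" "T \<noteq> {}" and cont: "continuous_on T G" "\<And>n. continuous_on T (F n)"
    and unif: "uniform_limit T F G sequentially"
  shows "(\<lambda>n. set_deviation (optimal_solutions T (\<lambda>t. ereal (F n t)))
                             (optimal_solutions T (\<lambda>t. ereal (G t)))) \<longlonglongrightarrow> 0"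
    (is "(\<lambda>n. set_deviation (?Sn n) ?S) \<longlonglongrightarrow> 0")
proof (rule order_tendstoI)
  fix c :: ereal
  assume "c < 0"
  have "0 \<le> set_deviation (?Sn n) ?S" for n
  proof -
    obtain x where "x \<in> ?Sn n"
      using optimal_solutions_nonempty[OF T cont(2)] by blast
    then show ?thesis
      unfolding set_deviation_def by (rule SUP_upper2) (auto intro: INF_greatest)
  qed
  with \<open>c < 0\<close> show "\<forall>\<^sub>F n in sequentially. c < set_deviation (?Sn n) ?S"
    by (intro always_eventually allI) (rule less_le_trans)
next
  fix c :: ereal
  assume "0 < c"
  then obtain e where e: "0 < e" "ereal e < c"
    using ereal_dense2 by (metis ereal_less(2))
  from optimal_solutions_eventually_near[OF T cont(1) unif e(1)]
  show "\<forall>\<^sub>F n in sequentially. set_deviation (?Sn n) ?S < c"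
  proof eventually_elim
    case (elim n)
    have "(INF y\<in>?S. ereal (dist x y)) \<le> ereal e" if "x \<in> ?Sn n" for x
      using elim that by (force intro: INF_lower2 less_imp_le)
    then have "set_deviation (?Sn n) ?S \<le> ereal e"
      unfolding set_deviation_def by (rule SUP_least)
    with e show ?case by order
  qed
qed


section \<open>Extended-real expectations\<close>

lemma ext_expectation_eq_integral:
  fixes y :: "'a \<Rightarrow> real"
  assumes int: "integrable M y" and eq: "AE \<omega> in M. Y \<omega> = ereal (y \<omega>)"
  shows "ext_expectation M Y = ereal (integral\<^sup>L M y)"
proof -
  have "(\<integral>\<^sup>+\<omega>. e2ennreal (Y \<omega>) \<partial>M) = (\<integral>\<^sup>+\<omega>. ennreal (y \<omega>) \<partial>M)"
       "(\<integral>\<^sup>+\<omega>. e2ennreal (- Y \<omega>) \<partial>M) = (\<integral>\<^sup>+\<omega>. ennreal (- y \<omega>) \<partial>M)"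
    using eq by (auto intro!: nn_integral_cong_AE)
  moreover have "enn2ereal x = ereal (enn2real x)" if "x \<noteq> \<infinity>" for x
    using that by (cases x) auto
  ultimately show ?thesis
    unfolding ext_expectation_def real_lebesgue_integral_def[OF int]
    using integrableD(2,3)[OF int] by simp
qed

text \<open>The bridge from the extended-real moment condition to ordinary integration theory: where the
square has a finite extended expectation, infinite values have probability zero.\<close>
lemma square_integrable_if_ext_expectation_finite:
  fixes Y :: "'a \<Rightarrow> ereal"
  assumes [measurable]: "Y \<in> borel_measurable M"
    and fin: "ext_expectation M (\<lambda>\<omega>. (Y \<omega>)\<^sup>2) < \<infinity>"
  shows "AE \<omega> in M. \<bar>Y \<omega>\<bar> \<noteq> \<infinity>"
    and "integrable M (\<lambda>\<omega>. (real_of_ereal (Y \<omega>))\<^sup>2)"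
proof -
  have [measurable]: "(\<lambda>\<omega>. (Y \<omega>)\<^sup>2) \<in> borel_measurable M"
    unfolding power2_eq_square by measurable
  have sq: "0 \<le> x\<^sup>2" for x :: ereal
    by (cases x) (auto simp: power2_eq_square)
  have nn: "(\<integral>\<^sup>+\<omega>. e2ennreal ((Y \<omega>)\<^sup>2) \<partial>M) \<noteq> \<infinity>"
    using fin by (auto simp: ext_expectation_def e2ennreal_neg sq)
  then have "AE \<omega> in M. e2ennreal ((Y \<omega>)\<^sup>2) \<noteq> \<infinity>"
    by (intro nn_integral_PInf_AE) auto
  then show AE: "AE \<omega> in M. \<bar>Y \<omega>\<bar> \<noteq> \<infinity>"
    by eventually_elim (auto simp: power2_eq_square)
  have "(\<integral>\<^sup>+\<omega>. ennreal ((real_of_ereal (Y \<omega>))\<^sup>2) \<partial>M) = (\<integral>\<^sup>+\<omega>. e2ennreal ((Y \<omega>)\<^sup>2) \<partial>M)"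
  proof (intro nn_integral_cong_AE, use AE in eventually_elim)
    case (elim \<omega>)
    then obtain r where r: "Y \<omega> = ereal r"
      by (cases "Y \<omega>") auto
    show ?case
      by (simp add: r)
  qed
  then show "integrable M (\<lambda>\<omega>. (real_of_ereal (Y \<omega>))\<^sup>2)"
    using nn by (intro integrableI_nonneg) (auto simp: less_top[symmetric])
qed


section \<open>Regularity of the loss function\<close>

context
  fixes u l :: "real \<Rightarrow> ereal"
  assumes utility: "utility_function u" and loss: "l = loss_function u"
begin

lemma mono_loss: "mono l"
  using utility by (auto simp: utility_function_def loss loss_function_def mono_def)

text \<open>The slope 1 affine majorant of \<open>u\<close> at 0, reflected; it passes through the origin as \<open>u 0 = 0\<close>.
In particular the loss never takes the value \<open>-\<infinity>\<close>, so it is real wherever it is less than \<open>\<infinity>\<close>.\<close>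
lemma loss_ge: "ereal z \<le> l z"
proof -
  have "u (- z) \<le> ereal (- z)"
    using utility by (auto simp: utility_function_def concave_subdifferential_def dest: spec[of _ "- z"])
  then show ?thesis
    unfolding loss loss_function_def by (cases "u (- z)") auto
qed

lemma loss_eq_real: "l z < \<infinity> \<Longrightarrow> l z = ereal (real_of_ereal (l z))"
  using loss_ge[of z] by (cases "l z") auto

lemma less_iff_real_loss: "l z < \<infinity> \<Longrightarrow> ereal c < l z \<longleftrightarrow> c < real_of_ereal (l z)"
  using loss_ge[of z] by (cases "l z") auto

lemma loss_finite_below: "l z0 < \<infinity> \<Longrightarrow> z \<le> z0 \<Longrightarrow> l z < \<infinity>"
  using monoD[OF mono_loss] by (rule le_less_trans)

lemma real_loss_mono: "l z0 < \<infinity> \<Longrightarrow> z \<le> z0 \<Longrightarrow> real_of_ereal (l z) \<le> real_of_ereal (l z0)"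
  using loss_eq_real[of z0] loss_eq_real[of z] loss_finite_below[of z0 z] monoD[OF mono_loss, of z z0]
  by (metis ereal_less_eq(3))

text \<open>Lower semicontinuity of the loss, as a consequence of the hypograph of \<open>u\<close> being closed.\<close>
lemma open_loss_superlevel: "open {z. c < l z}"
proof (cases c)
  case (real r)
  have "closed ((\<lambda>z. (- z, - r)) -` hypograph u)"
    using utility by (intro closed_vimage continuous_intros) (auto simp: utility_function_def)
  moreover have "(\<lambda>z. (- z, - r)) -` hypograph u = - {z. c < l z}"
  proof -
    have "ereal (- r) \<le> u (- z) \<longleftrightarrow> \<not> ereal r < - u (- z)" for z
      by (cases "u (- z)") auto
    then show ?thesis
      by (auto simp: hypograph_def loss loss_function_def real)
  qed
  ultimately show ?thesis
    by (simp add: closed_open)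
next
  case MInf
  have "- \<infinity> < l z" for z
    by (rule less_le_trans[OF _ loss_ge]) simp
  then have "{z. c < l z} = UNIV"
    using MInf by blast
  then show ?thesis by simp
qed simp

lemma borel_measurable_loss [measurable]: "l \<in> borel_measurable borel"
  by (rule borel_measurableI_greater) (simp add: open_loss_superlevel)

lemma convex_on_real_loss:
  assumes "l z0 < \<infinity>"
  shows "convex_on {..z0} (\<lambda>z. real_of_ereal (l z))"
proof (rule convex_onI)
  fix t x y :: real
  assume t: "0 < t" "t < 1" and "x \<in> {..z0}" "y \<in> {..z0}"
  let ?L = "\<lambda>z. real_of_ereal (l z)"
  have fin: "l x < \<infinity>" "l y < \<infinity>"
    using loss_finite_below[OF assms] \<open>x \<in> {..z0}\<close> \<open>y \<in> {..z0}\<close> by auto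
  have hypo: "(- z, - ?L z) \<in> hypograph u" if "l z < \<infinity>" for z
    using that loss_ge[of z] unfolding hypograph_def loss loss_function_def by (cases "u (- z)") auto
  have "(1 - t) *\<^sub>R (- x, - ?L x) + t *\<^sub>R (- y, - ?L y) \<in> hypograph u"
    using utility hypo[OF fin(1)] hypo[OF fin(2)] t
    by (intro convexD) (auto simp: utility_function_def proper_concave_def)
  then have "ereal (- ((1 - t) * ?L x + t * ?L y)) \<le> u (- ((1 - t) * x + t * y))"
    by (simp add: hypograph_def algebra_simps)
  then have "l ((1 - t) * x + t * y) \<le> ereal ((1 - t) * ?L x + t * ?L y)"
    unfolding loss loss_function_def by (cases "u (- ((1 - t) * x + t * y))") (auto simp: algebra_simps)
  then show "?L ((1 - t) *\<^sub>R x + t *\<^sub>R y) \<le> (1 - t) * ?L x + t * ?L y"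
    using loss_ge[of "(1 - t) * x + t * y"] by (cases "l ((1 - t) * x + t * y)") auto
qed simp

text \<open>In the interior of a ray on which it is finite, the loss is continuous by convexity. At the
endpoint only continuity from the left is claimed, and this follows from monotonicity (upper
bound) and lower semicontinuity (lower bound); the loss may jump to \<open>\<infinity>\<close> to the right of it.\<close>
lemma continuous_on_real_loss:
  assumes "l z0 < \<infinity>"
  shows "continuous_on {..z0} (\<lambda>z. real_of_ereal (l z))"
  unfolding continuous_on_eq_continuous_within
proof
  let ?L = "\<lambda>z. real_of_ereal (l z)"
  fix z assume "z \<in> {..z0}"
  show "continuous (at z within {..z0}) ?L"
  proof (cases "z = z0")
    case False
    have "continuous_on {..<z0} ?L"
      by (intro convex_on_continuous convex_on_subset[OF convex_on_real_loss[OF assms]]) auto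
    then have "isCont ?L z"
      using False \<open>z \<in> {..z0}\<close> by (simp add: continuous_on_eq_continuous_at)
    then show ?thesis
      by (rule continuous_at_imp_continuous_at_within)
  next
    case True
    have below: "\<forall>\<^sub>F x in at z0 within {..z0}. x \<le> z0"
      by (simp add: eventually_at_filter)
    show ?thesis
      unfolding True continuous_within
    proof (rule order_tendstoI)
      fix c assume "c < ?L z0"
      then have "z0 \<in> {x. ereal c < l x}"
        using less_iff_real_loss[OF assms] by simp
      then have "\<forall>\<^sub>F x in at z0 within {..z0}. ereal c < l x"
        unfolding eventually_at_topological
        by (intro exI[of _ "{x. ereal c < l x}"]) (simp add: open_loss_superlevel)
      with below show "\<forall>\<^sub>F x in at z0 within {..z0}. c < ?L x"
        by eventually_elim (use less_iff_real_loss loss_finite_below[OF assms] in blast)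
    next
      fix c assume c: "?L z0 < c"
      from below show "\<forall>\<^sub>F x in at z0 within {..z0}. ?L x < c"
        by eventually_elim (use real_loss_mono[OF assms] c in \<open>blast intro: le_less_trans\<close>)
    qed
  qed
qed

end


section \<open>Consistency of the sample average approximation\<close>

theorem proposition1:
  fixes u :: "real \<Rightarrow> ereal" and l :: "real \<Rightarrow> ereal"
    and M :: "'a measure" and \<xi> :: "'a \<Rightarrow> real" and X :: "nat \<Rightarrow> 'a \<Rightarrow> real"
    and T :: "real set"
    and v :: ereal and S :: "real set"
    and vn :: "nat \<Rightarrow> 'a \<Rightarrow> ereal" and Sn :: "nat \<Rightarrow> 'a \<Rightarrow> real set"
  assumes "utility_function u"
    and "l = loss_function u"
    and "prob_space M"
    and "\<xi> \<in> borel_measurable M"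
    and "compact T" and "is_interval T" and "T \<noteq> {}"
    and "v = optimal_value T (oce_objective l M \<xi>)"
    and "S = optimal_solutions T (oce_objective l M \<xi>)"
    and "prob_space.indep_vars M (\<lambda>_. borel) X {1..}"
    and "\<And>i. i \<ge> 1 \<Longrightarrow> distr M borel (X i) = distr M borel \<xi>"
    and "\<And>n \<omega>. vn n \<omega> = optimal_value T (saa_objective l X n \<omega>)"
    and "\<And>n \<omega>. Sn n \<omega> = optimal_solutions T (saa_objective l X n \<omega>)"
    and "(SUP t\<in>T. ext_expectation M (\<lambda>\<omega>. (l (\<xi> \<omega> - t))\<^sup>2)) < \<infinity>"
  shows "(AE \<omega> in M. (\<lambda>n. vn n \<omega>) \<longlonglongrightarrow> v)
       \<and> (AE \<omega> in M. (\<lambda>n. set_deviation (Sn n \<omega>) S) \<longlonglongrightarrow> 0)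
       \<and> (\<forall>tstar. S = {tstar} \<longrightarrow>
            (\<forall>tn :: nat \<Rightarrow> 'a \<Rightarrow> real. (AE \<omega> in M. \<forall>n\<ge>1. tn n \<omega> \<in> Sn n \<omega>) \<longrightarrow>
               (AE \<omega> in M. (\<lambda>n. tn n \<omega>) \<longlonglongrightarrow> tstar)))"
proof -
  interpret prob_space M by fact
  note loss_assms = assms(1,2)
  note [measurable] = assms(4) borel_measurable_loss[OF loss_assms]
  note finite_below = loss_finite_below[OF loss_assms]
  obtain a b where T: "T = {a..b}" and "a \<le> b"
    using assms(5-7) is_interval_compact[of T] by auto
  define L where "L z = real_of_ereal (l z)" for z
  have [measurable]: "L \<in> borel_measurable borel"
    unfolding L_def by measurable
  have l_eq: "l z = ereal (L z)" if "l z < \<infinity>" for z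
    unfolding L_def by (rule loss_eq_real[OF loss_assms that])
  have L_mono: "L z \<le> L z'" if "l z' < \<infinity>" "z \<le> z'" for z z'
    unfolding L_def by (rule real_loss_mono[OF loss_assms that])
  have L_cont: "continuous_on {a..b} (\<lambda>t. L (x - t))" if "l (x - a) < \<infinity>" for x
    unfolding L_def
    by (rule continuous_on_compose2[OF continuous_on_real_loss[OF loss_assms that]])
       (auto intro: continuous_on_diff)
  have fin_ab: "l (x - t) < \<infinity>" if "l (x - a) < \<infinity>" "t \<in> {a..b}" for x t
    using finite_below[OF that(1)] that(2) by simp

  have "ext_expectation M (\<lambda>\<omega>. (l (\<xi> \<omega> - t))\<^sup>2) < \<infinity>" if "t \<in> T" for t
    using assms(14) that by (meson SUP_upper le_less_trans)
  then have sq: "AE \<omega> in M. \<bar>l (\<xi> \<omega> - t)\<bar> \<noteq> \<infinity>"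
      "integrable M (\<lambda>\<omega>. (L (\<xi> \<omega> - t))\<^sup>2)" if "t \<in> {a..b}" for t
    using square_integrable_if_ext_expectation_finite[of "\<lambda>\<omega>. l (\<xi> \<omega> - t)" M] that
    unfolding T L_def by auto
  have int: "integrable M (\<lambda>\<omega>. L (\<xi> \<omega> - t))" if "t \<in> {a..b}" for t
    using square_integrable_imp_integrable[OF _ sq(2)[OF that]] by simp
  \<comment> \<open>Since the loss is nondecreasing, finiteness at the left endpoint \<open>a\<close> gives finiteness for all
    \<open>t\<close> in the interval at once, so one null set suffices.\<close>
  have fin: "AE \<omega> in M. l (\<xi> \<omega> - a) < \<infinity>"
    using sq(1)[of a] \<open>a \<le> b\<close> by (auto elim: eventually_mono)
  have X: "X i \<in> borel_measurable M" if "i \<ge> 1" for i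
    using assms(10) that unfolding indep_vars_def by simp
  have fin_sample: "AE \<omega> in M. \<forall>i\<in>{1..}. l (X i \<omega> - a) < \<infinity>"
  proof (rule AE_ball_countable[THEN iffD2])
    show "\<forall>i\<in>{1..}. AE \<omega> in M. l (X i \<omega> - a) < \<infinity>"
    proof
      fix i :: nat assume "i \<in> {1..}"
      then have i: "i \<ge> 1" by simp
      have "AE x in distr M borel \<xi>. l (x - a) < \<infinity>"
        using fin by (subst AE_distr_iff) auto
      then show "AE \<omega> in M. l (X i \<omega> - a) < \<infinity>"
        unfolding assms(11)[OF i, symmetric] using X[OF i] by (subst (asm) AE_distr_iff) auto
    qed
  qed simp

  define f where "f t = expectation (\<lambda>\<omega>. L (\<xi> \<omega> - t))" for t
  define F where "F n \<omega> t = (\<Sum>i=1..n. L (X i \<omega> - t)) / real n" for n \<omega> t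
  have oce: "oce_objective l M \<xi> t = ereal (t + f t)" if "t \<in> T" for t
  proof -
    have "AE \<omega> in M. l (\<xi> \<omega> - t) = ereal (L (\<xi> \<omega> - t))"
      using fin by eventually_elim (use l_eq fin_ab that T in blast)
    from ext_expectation_eq_integral[OF int this] that show ?thesis
      unfolding oce_objective_def f_def T by simp
  qed
  have saa: "saa_objective l X n \<omega> t = ereal (t + F n \<omega> t)"
    if "t \<in> T" and "\<forall>i\<in>{1..}. l (X i \<omega> - a) < \<infinity>" for n \<omega> t
  proof -
    have "(\<Sum>i=1..n. l (X i \<omega> - t)) = (\<Sum>i=1..n. ereal (L (X i \<omega> - t)))"
      using that l_eq[OF fin_ab] unfolding T by (intro sum.cong) simp_all
    then show ?thesis
      unfolding saa_objective_def F_def by simp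
  qed
  have v: "v = optimal_value T (\<lambda>t. ereal (t + f t))"
    and S: "S = optimal_solutions T (\<lambda>t. ereal (t + f t))"
    using assms(8,9) oce by (auto simp: optimal_value_def optimal_solutions_def)

  \<comment> \<open>Dominated convergence; by monotonicity the values at the endpoints dominate all others.\<close>
  have f_cont: "continuous_on T f"
    unfolding continuous_on_sequentially o_def
  proof (intro allI ballI impI)
    fix t :: "nat \<Rightarrow> real" and s
    assume "s \<in> T" and t: "(\<forall>n. t n \<in> T) \<and> t \<longlonglongrightarrow> s"
    show "(\<lambda>n. f (t n)) \<longlonglongrightarrow> f s"
      unfolding f_def
    proof (rule integral_dominated_convergence[where w="\<lambda>\<omega>. \<bar>L (\<xi> \<omega> - a)\<bar> + \<bar>L (\<xi> \<omega> - b)\<bar>"])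
      show "integrable M (\<lambda>\<omega>. \<bar>L (\<xi> \<omega> - a)\<bar> + \<bar>L (\<xi> \<omega> - b)\<bar>)"
        using \<open>a \<le> b\<close> by (intro Bochner_Integration.integrable_add integrable_abs int) auto
      show "AE \<omega> in M. (\<lambda>n. L (\<xi> \<omega> - t n)) \<longlonglongrightarrow> L (\<xi> \<omega> - s)"
        using fin
      proof eventually_elim
        case (elim \<omega>)
        then show ?case
          using L_cont[OF elim] t \<open>s \<in> T\<close> unfolding T continuous_on_sequentially o_def by blast
      qed
      show "AE \<omega> in M. norm (L (\<xi> \<omega> - t n)) \<le> \<bar>L (\<xi> \<omega> - a)\<bar> + \<bar>L (\<xi> \<omega> - b)\<bar>" for n
        using fin
      proof eventually_elim
        case (elim \<omega>)
        have "t n \<in> {a..b}"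
          using t T by blast
        then have "L (\<xi> \<omega> - b) \<le> L (\<xi> \<omega> - t n)" "L (\<xi> \<omega> - t n) \<le> L (\<xi> \<omega> - a)"
          using fin_ab[OF elim, of "t n"] elim by (auto intro!: L_mono)
        then show ?case by simp
      qed
    qed auto
  qed
  then have obj_cont: "continuous_on T (\<lambda>t. t + f t)"
    by (intro continuous_intros)

  \<comment> \<open>The strong law holds outside a null set that depends on \<open>t\<close>. Only countably many \<open>t\<close> are used, and
    monotonicity in \<open>t\<close> extends convergence from these to uniform convergence on \<open>T\<close>.\<close>
  have law: "AE \<omega> in M. (\<lambda>n. F n \<omega> t) \<longlonglongrightarrow> f t" if "t \<in> {a..b}" for t
    unfolding F_def f_def
  proof (rule strong_law_of_large_numbers_L2)
    show "indep_vars (\<lambda>_. borel) (\<lambda>i \<omega>. L (X i \<omega> - t)) {1..}"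
      using assms(10) by (rule indep_vars_compose2) simp
    show "distr M borel (\<lambda>\<omega>. L (X i \<omega> - t)) = distr M borel (\<lambda>\<omega>. L (\<xi> \<omega> - t))" if "i \<ge> 1" for i
      using arg_cong[OF assms(11)[OF that], of "\<lambda>N. distr N borel (\<lambda>x. L (x - t))"] X[OF that]
      by (simp add: distr_distr comp_def)
  qed (use sq that in auto)
  have "AE \<omega> in M. \<forall>q\<in>\<rat> \<inter> {0..1}. (\<lambda>n. F n \<omega> (a + (b - a) * q)) \<longlonglongrightarrow> f (a + (b - a) * q)"
  proof (rule AE_ball_countable[THEN iffD2])
    show "countable (\<rat> \<inter> {0..1::real})"
      using countable_rat by (rule countable_subset[rotated]) simp
    show "\<forall>q\<in>\<rat> \<inter> {0..1}. AE \<omega> in M. (\<lambda>n. F n \<omega> (a + (b - a) * q)) \<longlonglongrightarrow> f (a + (b - a) * q)"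
    proof (intro ballI law)
      fix q :: real
      assume "q \<in> \<rat> \<inter> {0..1}"
      then have "0 \<le> (b - a) * q" "(b - a) * q \<le> b - a"
        using \<open>a \<le> b\<close> by (auto intro: mult_left_le)
      then show "a + (b - a) * q \<in> {a..b}"
        by simp
    qed
  qed
  with fin_sample have "AE \<omega> in M. (\<forall>i\<in>{1..}. l (X i \<omega> - a) < \<infinity>) \<and> (\<forall>n. continuous_on T (F n \<omega>))
      \<and> uniform_limit T (\<lambda>n. F n \<omega>) f sequentially"
  proof eventually_elim
    case (elim \<omega>)
    have "L (X i \<omega> - t) \<le> L (X i \<omega> - s)" if "i \<ge> 1" "s \<in> {a..b}" "s \<le> t" for i s t
      using elim(1) that by (intro L_mono fin_ab[of _ s]) auto
    then have "antimono_on {a..b} (F n \<omega>)" for n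
      unfolding F_def by (intro monotone_onI divide_right_mono sum_mono) auto
    moreover have "continuous_on {a..b} (F n \<omega>)" for n
      unfolding F_def divide_inverse using elim(1) by (intro continuous_intros L_cont) auto
    ultimately show ?case
      using elim uniform_limit_of_antimono_functions[OF \<open>a \<le> b\<close>, of "\<lambda>n. F n \<omega>" f] f_cont
      unfolding T by blast
  qed
  then have good: "AE \<omega> in M. (\<forall>n. vn n \<omega> = optimal_value T (\<lambda>t. ereal (t + F n \<omega> t)))
      \<and> (\<forall>n. Sn n \<omega> = optimal_solutions T (\<lambda>t. ereal (t + F n \<omega> t)))
      \<and> (\<forall>n. continuous_on T (\<lambda>t. t + F n \<omega> t))
      \<and> uniform_limit T (\<lambda>n t. t + F n \<omega> t) (\<lambda>t. t + f t) sequentially"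
  proof eventually_elim
    case (elim \<omega>)
    have "vn n \<omega> = optimal_value T (\<lambda>t. ereal (t + F n \<omega> t))"
      "Sn n \<omega> = optimal_solutions T (\<lambda>t. ereal (t + F n \<omega> t))" for n
      using elim saa assms(12,13) by (auto simp: optimal_value_def optimal_solutions_def)
    with elim show ?case
      by (auto intro!: continuous_on_add continuous_on_id uniform_limit_add uniform_limit_const)
  qed

  show ?thesis
  proof (intro conjI allI impI)
    show "AE \<omega> in M. (\<lambda>n. vn n \<omega>) \<longlonglongrightarrow> v"
      using good
    proof eventually_elim
      case (elim \<omega>)
      then show ?case
        using optimal_value_tendsto[OF assms(5,7) obj_cont] by (simp add: v)
    qed
    show "AE \<omega> in M. (\<lambda>n. set_deviation (Sn n \<omega>) S) \<longlonglongrightarrow> 0"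
      using good
    proof eventually_elim
      case (elim \<omega>)
      then show ?case
        using set_deviation_optimal_solutions_tendsto_0[OF assms(5,7) obj_cont, of "\<lambda>n t. t + F n \<omega> t"]
        by (simp add: S)
    qed
  next
    fix tstar and tn :: "nat \<Rightarrow> 'a \<Rightarrow> real"
    assume tstar: "S = {tstar}" and tn: "AE \<omega> in M. \<forall>n\<ge>1. tn n \<omega> \<in> Sn n \<omega>"
    show "AE \<omega> in M. (\<lambda>n. tn n \<omega>) \<longlonglongrightarrow> tstar"
      using good tn
    proof eventually_elim
      case (elim \<omega>)
      show ?case
      proof (rule tendstoI)
        fix e :: real
        assume "e > 0"
        then have "\<forall>\<^sub>F n in sequentially. \<forall>x\<in>Sn n \<omega>. \<exists>y\<in>S. dist x y < e"
          using optimal_solutions_eventually_near[OF assms(5,7) obj_cont, of "\<lambda>n t. t + F n \<omega> t" e] elim(1)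
          by (simp add: S)
        then show "\<forall>\<^sub>F n in sequentially. dist (tn n \<omega>) tstar < e"
          using eventually_ge_at_top[of 1] by eventually_elim (use elim(2) tstar in auto)
      qed
    qed
  qed
qed

end
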